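(* Let $n$ be a positive integer, and let $p>3$ be a prime. Then $$\sum_{k=0}^{n-1}(2k+1)^{3}A_k \equiv 0\pmod{n^3},$$ $$\sum_{k=0}^{p-1}(2k+1)^{3}A_k \equiv p^3 \pmod{2p^6},$$ where $A_k$ denotes the $k$-th Apéry number.
   Context: The Apéry numbers are defined, for each nonnegative integer $n$, by $A_n=\sum_{k=0}^{n}\binom{n+k}{2k}^2\binom{2k}{k}^2$. *)

theory Defs
  imports "HOL-Number_Theory.Number_Theory"
begin

definition apery :: "nat \<Rightarrow> nat" where
  "apery n = (\<Sum>k=0..n. ((n + k) choose (2 * k))\<^sup>2 * ((2 * k) choose k)\<^sup>2)"

end

theory Submission
  imports Defs
begin

text \<open>
  Put $P_k(m) = {m \choose k}{m+k \choose k}$, so that $A_m = \sum_k P_k(m)^2$, and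
  $X_k = (n-k) P_k(n)$. For fixed $k$ the sum over $m$ telescopes:
  $(k+1) \sum_{m<n} (2m+1)^3 P_k(m)^2 = X_k^2 (2n^2-k-1)$. Up to the difference
  $k X_k^2 - (k+1) X_{k+1}^2$, the right-hand side divided by $k+1$ is an integer multiple
  of $n^3$, and summing over $k$ yields the closed form
  \[ \sum_{m<n} (2m+1)^3 A_m
    = n^3 \sum_{k<n} {n \choose k+1}^2 {n+k \choose k}{n+k \choose k+1}. \]
  If $n = p$ is prime, every summand on the right with $k < p-1$ is divisible by $p^3$, and the last
  one is ${2p-1 \choose p-1}^2 \equiv 1 \pmod{p^3}$ by Wolstenholme's theorem. The factor $2$
  in the modulus comes from $A_m$ being odd.
\<close>

section \<open>Apery numbers as sums of squared Legendre coefficients\<close>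

text \<open>Both sides count nested subsets of sizes \<open>k\<close> and \<open>2 * k\<close> in a
  set of size \<open>m + k\<close>; for \<open>k > m\<close> both vanish.\<close>

lemma choose_mult_central:
  "((m + k) choose (2 * k)) * ((2 * k) choose k) = (m choose k) * ((m + k) choose k)"
proof (cases "k \<le> m")
  case True
  then show ?thesis
    using choose_mult[of k "2 * k" "m + k"] by (simp add: mult_2 mult.commute)
qed (simp add: binomial_eq_0)

text \<open>Up to sign, the coefficient of \<open>x ^ k\<close> in the shifted Legendre polynomial
  of degree \<open>m\<close>. The index \<open>k\<close> comes first because it stays fixed while
  \<open>m\<close> is summed over.\<close>

definition legendre_coeff :: "nat \<Rightarrow> nat \<Rightarrow> nat" where
  "legendre_coeff k m = (m choose k) * ((m + k) choose k)"

text \<open>The bound \<open>n\<close> independent of \<open>m\<close> makes the later double sum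
  rectangular, so that its order can be swapped; the added terms have \<open>k > m\<close> and
  vanish.\<close>

lemma apery_eq_sum_legendre_coeff:
  assumes "m < n"
  shows "apery m = (\<Sum>k<n. (legendre_coeff k m)\<^sup>2)"
proof -
  have "apery m = (\<Sum>k=0..m. (legendre_coeff k m)\<^sup>2)"
    by (simp add: apery_def legendre_coeff_def choose_mult_central flip: power_mult_distrib)
  also have "\<dots> = (\<Sum>k<n. (legendre_coeff k m)\<^sup>2)"
    using assms by (intro sum.mono_neutral_left) (auto simp: legendre_coeff_def)
  finally show ?thesis .
qed

section \<open>Telescoping sums and the closed form\<close>

text \<open>Over the reals \<open>n - k\<close> is not truncated, so no case \<open>k > n\<close>
  has to be split off later.\<close>

lemma real_Suc_times_choose_Suc:
  "real (Suc k) * real (n choose Suc k) = (real n - real k) * real (n choose k)"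
proof (cases "k \<le> n")
  case True
  have "Suc k * (n choose Suc k) = (n - k) * (n choose k)"
    by (metis binomial_absorb_comp binomial_absorption)
  then show ?thesis
    using True by (metis of_nat_diff of_nat_mult)
qed (simp add: binomial_eq_0)

text \<open>Absorption in each binomial factor. Denominators are cleared because
  \<open>Suc n - k\<close> is zero at \<open>k = Suc n\<close>.\<close>

lemma legendre_coeff_Suc_arg:
  "(real (Suc n) - real k) * real (legendre_coeff k (Suc n))
    = (real (Suc n) + real k) * real (legendre_coeff k n)"
proof -
  have a: "(real (Suc n) - real k) * real (Suc n choose k) = real (Suc n) * real (n choose k)"
    using real_Suc_times_choose_Suc[of k "Suc n"] Suc_times_binomial_eq[of n k]
    by (metis of_nat_mult mult.commute)
  have "Suc n * (Suc (n + k) choose Suc n) = Suc (n + k) * ((n + k) choose n)"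
    using Suc_times_binomial_eq[of "n + k" n] by simp
  moreover have "Suc (n + k) choose Suc n = (Suc n + k) choose k" "(n + k) choose n = (n + k) choose k"
    using binomial_symmetric[of k "Suc n + k"] binomial_symmetric[of k "n + k"] by simp_all
  ultimately have b: "real (Suc n) * real ((Suc n + k) choose k)
      = (real (Suc n) + real k) * real ((n + k) choose k)"
    by (metis add_Suc of_nat_add of_nat_mult)
  have "(real (Suc n) - real k) * real (legendre_coeff k (Suc n))
      = ((real (Suc n) - real k) * real (Suc n choose k)) * real ((Suc n + k) choose k)"
    by (simp only: legendre_coeff_def of_nat_mult mult.assoc)
  also have "\<dots> = real (n choose k) * (real (Suc n) * real ((Suc n + k) choose k))"
    unfolding a by (simp only: mult_ac)
  also have "\<dots> = (real (Suc n) + real k) * real (legendre_coeff k n)"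
    unfolding b by (simp add: legendre_coeff_def)
  finally show ?thesis .
qed

lemma sum_odd_cubes_legendre_coeff_sq:
  "real (Suc k) * (\<Sum>m<n. (2 * real m + 1) ^ 3 * (real (legendre_coeff k m))\<^sup>2)
    = ((real n - real k) * real (legendre_coeff k n))\<^sup>2 * (2 * (real n)\<^sup>2 - real (Suc k))"
proof (induction n)
  case 0
  then show ?case by (cases k) (auto simp: legendre_coeff_def)
next
  case (Suc n)
  define P where "P = real (legendre_coeff k n)"
  have "real (Suc k) * (\<Sum>m<Suc n. (2 * real m + 1) ^ 3 * (real (legendre_coeff k m))\<^sup>2)
      = ((real n - real k) * P)\<^sup>2 * (2 * (real n)\<^sup>2 - real (Suc k))
        + real (Suc k) * ((2 * real n + 1) ^ 3 * P\<^sup>2)"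
    using Suc.IH by (simp add: P_def distrib_left)
  \<comment> \<open>A polynomial identity in \<open>n\<close> and \<open>k\<close> times
    \<open>P\<^sup>2\<close>; the recurrence in the argument then turns
    \<open>(Suc n + k) * P\<close> into the squared factor required at \<open>Suc n\<close>.\<close>
  also have "\<dots> = ((real (Suc n) + real k) * P)\<^sup>2 * (2 * (real (Suc n))\<^sup>2 - real (Suc k))"
    by (simp add: algebra_simps power2_eq_square power3_eq_cube)
  finally show ?case
    by (simp only: P_def legendre_coeff_Suc_arg)
qed

lemma legendre_coeff_Suc_index:
  "(real (Suc k))\<^sup>2 * real (legendre_coeff (Suc k) n)
    = (real n - real k) * (real n + real (Suc k)) * real (legendre_coeff k n)"
proof -
  have "Suc k * ((n + Suc k) choose Suc k) = (n + Suc k) * ((n + k) choose k)"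
    using Suc_times_binomial_eq[of "n + k" k] by (simp add: mult.commute)
  then have b: "real (Suc k) * real ((n + Suc k) choose Suc k)
      = (real n + real (Suc k)) * real ((n + k) choose k)"
    by (metis of_nat_add of_nat_mult)
  have "(real (Suc k))\<^sup>2 * real (legendre_coeff (Suc k) n)
      = (real (Suc k) * real (n choose Suc k)) * (real (Suc k) * real ((n + Suc k) choose Suc k))"
    by (simp add: legendre_coeff_def power2_eq_square algebra_simps)
  also have "\<dots> = (real n - real k) * (real n + real (Suc k)) * real (legendre_coeff k n)"
    unfolding b real_Suc_times_choose_Suc[of k n] by (simp only: legendre_coeff_def of_nat_mult mult_ac)
  finally show ?thesis .
qed

text \<open>All terms are rational multiples of \<open>(X k)\<^sup>2\<close>. With
  \<open>c = k + 1\<close> and \<open>N = n\<close>, the identity amounts to completing the square: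
  \<open>(N^2 - c^2)^2 / c^3 = N^4 / c^3 - 2 * N^2 / c + c\<close>.\<close>

lemma choose_product_telescope:
  fixes n :: nat
  defines "X \<equiv> \<lambda>k. (real n - real k) * real (legendre_coeff k n)"
  shows "(X k)\<^sup>2 * (2 * (real n)\<^sup>2 - real (Suc k)) / real (Suc k)
    = real (n ^ 3 * ((n choose Suc k)\<^sup>2 * ((n + k) choose k) * ((n + k) choose Suc k)))
      + (real k * (X k)\<^sup>2 - real (Suc k) * (X (Suc k))\<^sup>2)"
proof -
  define c where "c = real (Suc k)"
  define N where "N = real n"
  have c: "c \<noteq> 0" "real k = c - 1" by (simp_all add: c_def)
  have "c\<^sup>2 * X (Suc k) = (N\<^sup>2 - c\<^sup>2) * X k"
  proof -
    have "c\<^sup>2 * X (Suc k) = (N - c) * (c\<^sup>2 * real (legendre_coeff (Suc k) n))"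
      by (simp add: X_def c_def N_def)
    also have "\<dots> = (N\<^sup>2 - c\<^sup>2) * X k"
      unfolding c_def N_def legendre_coeff_Suc_index X_def
      by (simp add: power2_eq_square algebra_simps)
    finally show ?thesis .
  qed
  then have X': "X (Suc k) = (N\<^sup>2 - c\<^sup>2) * X k / c\<^sup>2"
    using c by (simp add: field_simps)
  define u where "u = real (n choose Suc k)"
  define v where "v = real ((n + k) choose k)"
  define w where "w = real ((n + k) choose Suc k)"
  have u: "c * u * v = X k"
    using real_Suc_times_choose_Suc[of k n]
    by (simp add: c_def u_def v_def X_def legendre_coeff_def)
  have w: "c * w = N * v"
    using real_Suc_times_choose_Suc[of k "n + k"] by (simp add: c_def w_def v_def N_def)
  have "c ^ 3 * (u\<^sup>2 * v * w) = (c * u)\<^sup>2 * v * (c * w)"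
    by (simp add: power2_eq_square power3_eq_cube algebra_simps)
  also have "\<dots> = N * (X k)\<^sup>2"
    unfolding w u[symmetric] by (simp add: power2_eq_square algebra_simps)
  finally have Y: "u\<^sup>2 * v * w = N * (X k)\<^sup>2 / c ^ 3"
    using c by (simp add: field_simps)
  have "(X k)\<^sup>2 * (2 * N\<^sup>2 - c) / c
      = N ^ 3 * (N * (X k)\<^sup>2 / c ^ 3) + ((c - 1) * (X k)\<^sup>2 - c * ((N\<^sup>2 - c\<^sup>2) * X k / c\<^sup>2)\<^sup>2)"
    using c(1) by (simp add: divide_simps) (simp add: algebra_simps power_numeral_reduce)
  then show ?thesis
    unfolding Y[symmetric] X'[symmetric] c(2)[symmetric]
    by (simp add: u_def v_def w_def N_def c_def)
qed

theorem sum_odd_cubes_apery: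
  "(\<Sum>m<n. (2 * m + 1) ^ 3 * apery m)
    = n ^ 3 * (\<Sum>k<n. (n choose Suc k)\<^sup>2 * ((n + k) choose k) * ((n + k) choose Suc k))"
proof -
  define X where "X = (\<lambda>k. (real n - real k) * real (legendre_coeff k n))"
  define Y where "Y = (\<lambda>k. (n choose Suc k)\<^sup>2 * ((n + k) choose k) * ((n + k) choose Suc k))"
  have inner: "(\<Sum>m<n. (2 * real m + 1) ^ 3 * (real (legendre_coeff k m))\<^sup>2)
      = real (n ^ 3 * Y k) + (real k * (X k)\<^sup>2 - real (Suc k) * (X (Suc k))\<^sup>2)" for k
  proof -
    have "(\<Sum>m<n. (2 * real m + 1) ^ 3 * (real (legendre_coeff k m))\<^sup>2)
        = (X k)\<^sup>2 * (2 * (real n)\<^sup>2 - real (Suc k)) / real (Suc k)"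
      unfolding X_def
      by (intro eq_divide_imp of_nat_neq_0, subst mult.commute) (rule sum_odd_cubes_legendre_coeff_sq)
    then show ?thesis
      unfolding X_def Y_def by (simp only: choose_product_telescope)
  qed
  have "real (\<Sum>m<n. (2 * m + 1) ^ 3 * apery m)
      = (\<Sum>m<n. \<Sum>k<n. (2 * real m + 1) ^ 3 * (real (legendre_coeff k m))\<^sup>2)"
    by (simp add: apery_eq_sum_legendre_coeff[of _ n] sum_distrib_left add.commute)
  also have "\<dots> = (\<Sum>k<n. \<Sum>m<n. (2 * real m + 1) ^ 3 * (real (legendre_coeff k m))\<^sup>2)"
    by (rule sum.swap)
  also have "\<dots> = real (n ^ 3 * (\<Sum>k<n. Y k))
      + (\<Sum>k<n. real k * (X k)\<^sup>2 - real (Suc k) * (X (Suc k))\<^sup>2)"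
    by (simp add: inner sum.distrib sum_distrib_left)
  \<comment> \<open>Both boundary terms vanish: the one at \<open>0\<close> by its factor
    \<open>k\<close>, the one at \<open>n\<close> because \<open>X n = 0\<close>.\<close>
  also have "(\<Sum>k<n. real k * (X k)\<^sup>2 - real (Suc k) * (X (Suc k))\<^sup>2) = 0"
    by (subst sum_lessThan_telescope') (simp add: X_def)
  finally show ?thesis
    unfolding Y_def by (simp only: add_0_right of_nat_eq_iff)
qed

section \<open>Parity of the Apery numbers and Wolstenholme's theorem\<close>

text \<open>The term \<open>k = 0\<close> is 1. For \<open>k > 0\<close> Pascal's rule writes the
  central binomial coefficient as a sum of two equal ones, so the term is even.\<close>

lemma odd_apery: "odd (apery n)"
proof -
  have "even ((2 * k) choose k)" if "k > 0" for k :: nat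
  proof -
    from that obtain j where "k = Suc j" by (cases k) auto
    moreover have "Suc (2 * j) choose Suc j = Suc (2 * j) choose j"
      using binomial_symmetric[of j "Suc (2 * j)"] by simp
    ultimately show ?thesis by simp
  qed
  then have "even (\<Sum>k=Suc 0..n. ((n + k) choose (2 * k))\<^sup>2 * ((2 * k) choose k)\<^sup>2)"
    by (intro dvd_sum) auto
  then show ?thesis
    by (simp add: apery_def sum.atLeast_Suc_atMost)
qed

text \<open>Six times the sum is \<open>p * (p - 1) * (2 * p - 1)\<close>, and a prime above 3 does
  not divide 6.\<close>

lemma prime_dvd_sum_squares:
  fixes p :: nat
  assumes "prime p" "p > 3"
  shows "p dvd (\<Sum>j=1..<p. j\<^sup>2)"
proof -
  have "6 * (\<Sum>j=1..<m. j\<^sup>2) = m * ((m - 1) * (2 * m - 1))" if "m > 0" for m :: nat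
    using that
  proof (induction m rule: nat_induct_non_zero)
    case (Suc m)
    then show ?case 
      by (cases m) (simp_all add: power2_eq_square algebra_simps)
  qed simp
  then have "p dvd 6 * (\<Sum>j=1..<p. j\<^sup>2)"
    using assms by (metis dvd_triv_left prime_gt_0_nat)
  moreover have "\<not> p dvd 6"
  proof
    assume "p dvd 6"
    then have "p dvd 2 \<or> p dvd 3"
      using prime_dvd_multD[of p 2 3] assms by simp
    then show False using assms by (auto dest: dvd_imp_le)
  qed
  ultimately show ?thesis
    using assms by (simp add: prime_dvd_mult_iff)
qed

text \<open>By Pascal's rule neighbouring entries of row \<open>p - 1\<close> add up to an inner
  entry of row \<open>p\<close>, which \<open>p\<close> divides; hence the signs alternate.\<close>

lemma prime_choose_pred_cong:
  assumes "prime p" "i < p"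
  shows "[int ((p - 1) choose i) = (-1) ^ i] (mod int p)"
  using assms(2)
proof (induction i)
  case (Suc i)
  have "int ((p - 1) choose i) + int ((p - 1) choose Suc i) = int (p choose Suc i)"
    using prime_gt_0_nat[OF assms(1)] by (cases p) auto
  moreover have "p dvd p choose Suc i"
    using assms Suc.prems by (intro dvd_choose_prime) auto
  ultimately have "[int ((p - 1) choose i) + int ((p - 1) choose Suc i) = 0] (mod int p)"
    by (simp add: cong_0_iff)
  from cong_diff[OF this Suc.IH] show ?case
    using Suc.prems by simp
qed simp

text \<open>Inversion permutes the nonzero residues, so the sum is congruent to the sum of all their
  squares.\<close>

lemma prime_dvd_sum_inverse_squares:
  fixes c :: "nat \<Rightarrow> int"
  assumes "prime p" "p > 3"
    and inv: "\<And>i. i \<in> {1..<p} \<Longrightarrow> [int i * c i = 1] (mod int p)"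
  shows "int p dvd (\<Sum>i=1..<p. (c i)\<^sup>2)"
proof -
  \<comment> \<open>The least nonnegative representative of the inverse, which makes inversion a
    self-map of \<open>{1..<p}\<close>.\<close>
  define g where "g = (\<lambda>i. nat (c i mod int p))"
  have g: "[int (g i) = c i] (mod int p)" for i
    using assms(2) by (simp add: g_def)
  have g1: "[int i * int (g i) = 1] (mod int p)" if "i \<in> {1..<p}" for i
    using cong_trans[OF cong_scalar_left[OF g] inv[OF that]] .
  have "g ` {1..<p} \<subseteq> {1..<p}"
  proof
    fix x assume "x \<in> g ` {1..<p}"
    then obtain i where i: "i \<in> {1..<p}" "x = g i" by blast
    have "x \<noteq> 0"
      using g1[OF i(1)] i(2) assms(2) by (intro notI) (simp add: cong_def)
    moreover have "x < p"
      using assms(2) by (simp add: i(2) g_def nat_less_iff)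
    ultimately show "x \<in> {1..<p}" by simp
  qed
  moreover have "inj_on g {1..<p}"
  proof
    fix i j assume ij: "i \<in> {1..<p}" "j \<in> {1..<p}" "g i = g j"
    \<comment> \<open>If \<open>g i = g j\<close>, the product \<open>i * g i * j\<close> is
      congruent both to \<open>j\<close> and to \<open>i\<close>.\<close>
    have "[int i * (int (g i) * int j) = int j] (mod int p)"
      using cong_scalar_right[OF g1[OF ij(1)], of "int j"] by (simp add: mult.assoc)
    moreover have "[int i * (int (g i) * int j) = int i] (mod int p)"
      using cong_scalar_left[OF g1[OF ij(2)], of "int i"] ij(3) by (simp add: mult.commute)
    ultimately have "[int i = int j] (mod int p)"
      by (metis cong_sym cong_trans)
    then show "i = j"
      using ij(1,2) by (simp add: cong_int_iff cong_def)
  qed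
  ultimately have "bij_betw g {1..<p} {1..<p}"
    by (simp add: bij_betw_def endo_inj_surj)
  then have "(\<Sum>i=1..<p. (g i)\<^sup>2) = (\<Sum>j=1..<p. j\<^sup>2)"
    by (rule sum.reindex_bij_betw)
  then have "[int (\<Sum>i=1..<p. (g i)\<^sup>2) = 0] (mod int p)"
    using prime_dvd_sum_squares[OF assms(1,2)] by (simp only: cong_0_iff int_dvd_int_iff)
  moreover have "[int (\<Sum>i=1..<p. (g i)\<^sup>2) = (\<Sum>i=1..<p. (c i)\<^sup>2)] (mod int p)"
    unfolding of_nat_sum of_nat_power by (intro cong_sum cong_pow g)
  ultimately show ?thesis
    by (metis cong_0_iff cong_sym cong_trans)
qed

text \<open>
  Vandermonde gives ${2p \choose p} = 2 + \sum_{0<i<p} {p \choose i}^2$, and ${p \choose i}/p$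
  is congruent to $\pm 1/i$ modulo $p$.
\<close>

theorem wolstenholme:
  assumes "prime p" "p > 3"
  shows "[(2 * p - 1) choose (p - 1) = 1] (mod p ^ 3)"
proof -
  define b where "b = (\<lambda>i. (p choose i) div p)"
  have b: "p choose i = p * b i" if "i \<in> {1..<p}" for i
    using that assms dvd_choose_prime[of i p] by (auto simp: b_def)
  \<comment> \<open>The sign cancels that of \<open>(p - 1) choose (i - 1)\<close> modulo
    \<open>p\<close>, so \<open>c i\<close> inverts \<open>i\<close>; it disappears on
    squaring.\<close>
  define c where "c = (\<lambda>i. (- 1) ^ (i - 1) * int (b i))"
  have "[int i * c i = 1] (mod int p)" if i: "i \<in> {1..<p}" for i
  proof -
    have "p * (i * b i) = p * ((p - 1) choose (i - 1))"
      using times_binomial_minus1_eq[of i p] b[OF i] i by (simp add: mult.left_commute)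
    then have "i * b i = (p - 1) choose (i - 1)"
      using assms(2) by simp
    then have "int i * c i = (- 1) ^ (i - 1) * int ((p - 1) choose (i - 1))"
      unfolding c_def by (metis mult.left_commute of_nat_mult)
    moreover have "[(- 1) ^ (i - 1) * int ((p - 1) choose (i - 1)) =
        (- 1) ^ (i - 1) * (- 1) ^ (i - 1)] (mod int p)"
      using i assms(1) by (intro cong_scalar_left prime_choose_pred_cong) auto
    ultimately show ?thesis
      by (simp flip: power_mult_distrib)
  qed
  then have "int p dvd (\<Sum>i=1..<p. (c i)\<^sup>2)"
    by (rule prime_dvd_sum_inverse_squares[OF assms])
  also have "(\<Sum>i=1..<p. (c i)\<^sup>2) = int (\<Sum>i=1..<p. (b i)\<^sup>2)"
    by (simp add: c_def power_mult_distrib flip: power_mult)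
  finally have "p dvd (\<Sum>i=1..<p. (b i)\<^sup>2)"
    by (simp only: int_dvd_int_iff)
  then have dvd: "p ^ 3 dvd p\<^sup>2 * (\<Sum>i=1..<p. (b i)\<^sup>2)"
    by (simp add: power3_eq_cube power2_eq_square)
  \<comment> \<open>The two end terms of the Vandermonde sum contribute the 2.\<close>
  have "{..p} = insert 0 (insert p {1..<p})"
    using assms(2) by auto
  then have "(2 * p) choose p = 2 + (\<Sum>i=1..<p. (p choose i)\<^sup>2)"
    using assms(2) by (simp add: choose_square_sum[symmetric])
  also have "(\<Sum>i=1..<p. (p choose i)\<^sup>2) = p\<^sup>2 * (\<Sum>i=1..<p. (b i)\<^sup>2)"
    by (simp add: sum_distrib_left b power_mult_distrib)
  finally have "(2 * p) choose p = 2 + p\<^sup>2 * (\<Sum>i=1..<p. (b i)\<^sup>2)" .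
  moreover have "(2 * p) choose p = 2 * ((2 * p - 1) choose (p - 1))"
    using times_binomial_minus1_eq[of p "2 * p"] assms(2) by simp
  ultimately have "[2 * ((2 * p - 1) choose (p - 1)) = 2 * 1] (mod p ^ 3)"
    using dvd cong_add_lcancel_0_nat[of 2 _ "p ^ 3"] by (simp add: cong_0_iff)
  moreover have "coprime 2 (p ^ 3)"
    using assms primes_coprime[of 2 p] by simp
  ultimately show ?thesis
    by (simp only: cong_mult_lcancel_nat)
qed

section \<open>The closed form at a prime\<close>

lemma sum_choose_products_cong:
  assumes "prime p" "p > 3"
  shows "[(\<Sum>k<p. (p choose Suc k)\<^sup>2 * ((p + k) choose k) * ((p + k) choose Suc k)) = 1] (mod p ^ 3)"
proof -
  define f where "f = (\<lambda>k. (p choose Suc k)\<^sup>2 * ((p + k) choose k) * ((p + k) choose Suc k))"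
  have "[f k = 0] (mod p ^ 3)" if k: "k < p - 1" for k
  proof -
    have 1: "p dvd p choose Suc k"
      using assms k by (intro dvd_choose_prime) auto
    \<comment> \<open>Absorption: the product equals \<open>p * ((p + k) choose k)\<close>.\<close>
    have "p dvd Suc k * ((p + k) choose Suc k)"
      by (metis add_diff_cancel_right' binomial_absorb_comp binomial_absorption dvd_triv_left)
    moreover have "\<not> p dvd Suc k"
      using k by (auto dest: dvd_imp_le)
    ultimately have 2: "p dvd (p + k) choose Suc k"
      using assms(1) prime_dvd_mult_iff by blast
    \<comment> \<open>The squared binomial gives \<open>p\<^sup>2\<close>, the last factor the
      remaining \<open>p\<close>.\<close>
    have "p\<^sup>2 * 1 * p dvd f k"
      unfolding f_def using 1 2 by (intro mult_dvd_mono dvd_power_same) auto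
    then show ?thesis
      by (simp add: cong_0_iff power2_eq_square power3_eq_cube)
  qed
  then have "[(\<Sum>k<p - 1. f k) = (\<Sum>k<p - 1. 0)] (mod p ^ 3)"
    by (intro cong_sum) auto
  moreover have "[f (p - 1) = 1 * 1] (mod p ^ 3)"
  proof -
    have "(2 * p - 1) choose p = (2 * p - 1) choose (p - 1)"
      using binomial_symmetric[of p "2 * p - 1"] assms(2) by simp
    then have "f (p - 1) = ((2 * p - 1) choose (p - 1)) * ((2 * p - 1) choose (p - 1))"
      using assms(2) by (simp add: f_def mult_2)
    then show ?thesis
      using cong_mult[OF wolstenholme wolstenholme] assms by metis
  qed
  ultimately have "[(\<Sum>k<p - 1. f k) + f (p - 1) = 1] (mod p ^ 3)"
    using cong_add by fastforce
  then show ?thesis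
    using sum.lessThan_Suc[of f "p - 1"] assms(2) by (simp add: f_def)
qed

theorem theorem1p3:
  fixes n p :: nat
  assumes "n > 0" and "prime p" and "p > 3"
  shows "[(\<Sum>k=0..<n. (2 * k + 1) ^ 3 * apery k) = 0] (mod n ^ 3)
    \<and> [(\<Sum>k=0..<p. (2 * k + 1) ^ 3 * apery k) = p ^ 3] (mod (2 * p ^ 6))"
proof
  show "[(\<Sum>k=0..<n. (2 * k + 1) ^ 3 * apery k) = 0] (mod n ^ 3)"
    by (simp only: atLeast0LessThan sum_odd_cubes_apery cong_0_iff dvd_triv_left)
  define S where "S = (\<Sum>k=0..<p. (2 * k + 1) ^ 3 * apery k)"
  have "odd p"
    using assms prime_odd_nat by simp
  \<comment> \<open>Every summand is odd, so the parity is that of the number of summands.\<close>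
  have "even (\<Sum>k=0..<m. (2 * k + 1) ^ 3 * apery k) \<longleftrightarrow> even m" for m
    by (induction m) (simp_all add: odd_apery)
  then have "[S = p ^ 3] (mod 2)"
    using \<open>odd p\<close> by (simp add: S_def cong_def mod_2_eq_odd)
  moreover have "[S = p ^ 3] (mod p ^ 6)"
  proof -
    define Z where "Z = (\<Sum>k<p. (p choose Suc k)\<^sup>2 * ((p + k) choose k) * ((p + k) choose Suc k))"
    have "S = p ^ 3 * Z"
      unfolding S_def Z_def atLeast0LessThan by (rule sum_odd_cubes_apery)
    \<comment> \<open>The factor \<open>p ^ 3\<close> of the closed form lifts the congruence for
      \<open>Z\<close> from modulus \<open>p ^ 3\<close> to \<open>p ^ 6\<close>.\<close>
    moreover have "[p ^ 3 * Z = p ^ 3 * 1] (mod p ^ 3 * p ^ 3)"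
      using sum_choose_products_cong[OF assms(2,3)] unfolding Z_def
      by (rule cong_cmult_leftI)
    ultimately show ?thesis
      by (simp flip: power_add)
  qed
  moreover have "coprime 2 (p ^ 6)"
    using \<open>odd p\<close> by simp
  ultimately show "[S = p ^ 3] (mod (2 * p ^ 6))"
    by (rule coprime_cong_mult_nat)
qed

end
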